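(* Let $V$ be an AM-algebra, let $E\subseteq V_+$ be a GG-convex set, let $m\in\mathbb{N}$, and let $f:E\to[0,\infty]^m$ be a map. Consider the statements: (a) $f$ is GG-convex; (b) the epigraph $\operatorname{epi}(f)$ is GG-convex; (c) the geometric epigraph $\operatorname{epi}^G(f)$ is GG-convex. Then (a) implies (b), and (b) is equivalent to (c). If $f$ takes values in $[0,\infty)^m$, then (b) implies (a).
   Context: A Riesz space is an ordered real vector space in which any two elements have a supremum and an infimum; $V_+=\{x: x\ge0\}$. An AM-space with unit $\mathbf{e}$ is a Banach lattice with order unit $\mathbf{e}$ (i.e. $\mathbf{e}>0$ and for every $x$ there is $\lambda>0$ with $|x|\le\lambda\mathbf{e}$) equipped with the norm $\|x\|_{\mathbf{e}}=\inf\{\lambda>0:|x|\le\lambda\mathbf{e}\}$. An AM-algebra with unit $\mathbf{e}$ is an AM-space $V$ with unit $\mathbf{e}$ that is also a real associative algebra such that products of elements of $V_+$ lie in $V_+$, the norm is submultiplicative, and $\mathbf{e}$ is also the multiplicative identity. Such a $V$ is isometric, as a lattice and as an algebra, to some $C(K)$, $K$ compact Hausdorff, with pointwise operations, via a map $\Phi$ with $\Phi(\mathbf e)=\mathbf 1_K$; powers are $x^t:=\Phi^{-1}((\Phi(x))^t)$ for $x\in V_+$, $t\ge 0$. A subset $A$ of the positive cone of an AM-algebra is GG-convex if $a^\lambda b^{1-\lambda}\in A$ for all $a,b\in A$, $\lambda\in(0,1)$. $V\times\mathbb{R}^m$ is regarded as an AM-algebra with componentwise operations, so $(x,\alpha)^\lambda\cdot(y,\beta)^{1-\lambda}=(x^\lambda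 y^{1-\lambda},\alpha^\lambda\beta^{1-\lambda})$, with operations in $\mathbb{R}^m$ componentwise. A map $f:E\to[0,\infty]^m$ on a GG-convex set $E\subseteq V_+$ is GG-convex if $f(x^\lambda y^{1-\lambda})\le f(x)^\lambda f(y)^{1-\lambda}$ for all $x,y\in E$, $\lambda\in(0,1)$ (componentwise, with $\infty^\lambda=\infty$ and $0\cdot\infty=0$). Further, $\operatorname{epi}(f)=\{(x,\alpha)\in E\times\mathbb{R}^m: f(x)\le\alpha\}$ and $\operatorname{epi}^G(f)=\{(x,\alpha)\in E\times(0,\infty)^m: f(x)\le\alpha\}$. *)

theory Defs
  imports "HOL-Analysis.Analysis" "HOL-Library.Lattice_Algebras"
begin

class banach_lattice = banach + ordered_real_vector + lattice_ab_group_add_abs +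
  assumes norm_abs_mono: "\<bar>x\<bar> \<le> \<bar>y\<bar> \<Longrightarrow> norm x \<le> norm y"

text \<open>
  The order unit of an AM-algebra is its multiplicative identity, so it is written \<open>1\<close>.
  Submultiplicativity of the norm is part of \<open>real_normed_algebra_1\<close>; the further axiom
  \<open>norm 1 = 1\<close> of that class is implied by \<open>norm_eq_Inf\<close> and \<open>1 > 0\<close>.
\<close>

class am_algebra = banach_lattice + real_normed_algebra_1 +
  assumes mult_nonneg: "0 \<le> x \<Longrightarrow> 0 \<le> y \<Longrightarrow> 0 \<le> x * y"
    and unit_positive: "0 < 1"
    and order_unit: "\<exists>l>0. \<bar>x\<bar> \<le> l *\<^sub>R 1"
    and norm_eq_Inf: "norm x = Inf {l. 0 < l \<and> \<bar>x\<bar> \<le> l *\<^sub>R 1}"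

text \<open>
  \<open>am_representation K \<Phi>\<close>: \<open>K\<close> is a compact Hausdorff space and \<open>\<Phi>\<close> is an isometric isomorphism
  of lattices and of unital algebras onto \<open>C(K)\<close>. The elements of \<open>C(K)\<close> are the continuous
  functions that are extensional on \<open>topspace K\<close>, hence the pointwise conditions determine them.
\<close>

definition am_representation :: "'k topology \<Rightarrow> ('v::am_algebra \<Rightarrow> 'k \<Rightarrow> real) \<Rightarrow> bool" where
  "am_representation K \<Phi> \<longleftrightarrow>
     compact_space K \<and> Hausdorff_space K \<and>
     bij_betw \<Phi> UNIV (mspace (cfunspace K euclidean_metric)) \<and>
     (\<forall>x y. mdist (cfunspace K euclidean_metric) (\<Phi> x) (\<Phi> y) = dist x y) \<and>
     (\<forall>k\<in>topspace K.
        (\<forall>x y. \<Phi> (x + y) k = \<Phi> x k + \<Phi> y k) \<and>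
        (\<forall>c x. \<Phi> (c *\<^sub>R x) k = c * \<Phi> x k) \<and>
        (\<forall>x y. \<Phi> (x * y) k = \<Phi> x k * \<Phi> y k) \<and>
        (\<forall>x y. \<Phi> (sup x y) k = sup (\<Phi> x k) (\<Phi> y k)) \<and>
        (\<forall>x y. \<Phi> (inf x y) k = inf (\<Phi> x k) (\<Phi> y k)) \<and>
        \<Phi> 1 k = 1)"

text \<open>
  A choice of \<open>(K, \<Phi>)\<close>. Taking the points of \<open>K\<close> from \<open>'v \<Rightarrow> real\<close> is no restriction:
  a point \<open>k\<close> of an arbitrary representing space is determined by its evaluation functional
  \<open>\<lambda>x. \<Phi> x k\<close>, so every representing space has a homeomorphic copy in this type.
\<close>

definition am_rep :: "('v::am_algebra \<Rightarrow> real) topology \<times> ('v \<Rightarrow> ('v \<Rightarrow> real) \<Rightarrow> real)" where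
  "am_rep = (SOME (K, \<Phi>). am_representation K \<Phi>)"

text \<open>Real powers with \<open>0\<^sup>0 = 1\<close>, in contrast to \<open>0 powr 0 = 0\<close>.\<close>

definition rpow :: "real \<Rightarrow> real \<Rightarrow> real" where
  "rpow a t = (if t = 0 then 1 else a powr t)"

definition am_pow :: "'v::am_algebra \<Rightarrow> real \<Rightarrow> 'v" where
  "am_pow x t = (case am_rep of (K, \<Phi>) \<Rightarrow>
     inv_into UNIV \<Phi> (\<lambda>k\<in>topspace K. rpow (\<Phi> x k) t))"

definition vec_pow :: "real ^ 'm \<Rightarrow> real \<Rightarrow> real ^ 'm" where
  "vec_pow a t = (\<chi> i. rpow (a $ i) t)"

definition ennreal_pow :: "ennreal \<Rightarrow> real \<Rightarrow> ennreal" where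
  "ennreal_pow a t = (if a = \<infinity> then \<infinity> else ennreal (rpow (enn2real a) t))"

text \<open>
  GG-convexity in an algebra with positive cone \<open>P\<close>, multiplication \<open>mul\<close> and powers \<open>pow\<close>.
  The operations are parameters because the library norm on \<open>'v \<times> (real ^ 'm)\<close> is Euclidean, so
  that type is not an instance of \<open>am_algebra\<close>; only its componentwise operations enter here.
\<close>

definition gg_convex_wrt ::
    "'a set \<Rightarrow> ('a \<Rightarrow> 'a \<Rightarrow> 'a) \<Rightarrow> ('a \<Rightarrow> real \<Rightarrow> 'a) \<Rightarrow> 'a set \<Rightarrow> bool" where
  "gg_convex_wrt P mul pow A \<longleftrightarrow>
     A \<subseteq> P \<and> (\<forall>a\<in>A. \<forall>b\<in>A. \<forall>l\<in>{0<..<1}. mul (pow a l) (pow b (1 - l)) \<in> A)"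

definition gg_convex :: "'v::am_algebra set \<Rightarrow> bool" where
  "gg_convex A \<longleftrightarrow> gg_convex_wrt {0..} (*) am_pow A"

definition gg_convex_prod :: "('v::am_algebra \<times> (real ^ 'm)) set \<Rightarrow> bool" where
  "gg_convex_prod A \<longleftrightarrow>
     gg_convex_wrt ({0..} \<times> {0..})
       (\<lambda>(x, a) (y, b). (x * y, a * b))
       (\<lambda>(x, a) t. (am_pow x t, vec_pow a t)) A"

definition gg_convex_map :: "'v::am_algebra set \<Rightarrow> ('v \<Rightarrow> ennreal ^ 'm) \<Rightarrow> bool" where
  "gg_convex_map E f \<longleftrightarrow>
     (\<forall>x\<in>E. \<forall>y\<in>E. \<forall>l\<in>{0<..<1}. \<forall>i.
        f (am_pow x l * am_pow y (1 - l)) $ i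
          \<le> ennreal_pow (f x $ i) l * ennreal_pow (f y $ i) (1 - l))"

text \<open>
  The comparison with real vectors takes place in \<open>ereal\<close>: the coercion \<open>ennreal\<close> sends negative
  numbers to \<open>0\<close> and would put points with negative coordinates into the epigraph.
\<close>

definition epi :: "'v::am_algebra set \<Rightarrow> ('v \<Rightarrow> ennreal ^ 'm) \<Rightarrow> ('v \<times> (real ^ 'm)) set" where
  "epi E f = {(x, a). x \<in> E \<and> (\<forall>i. enn2ereal (f x $ i) \<le> ereal (a $ i))}"

definition epi_G :: "'v::am_algebra set \<Rightarrow> ('v \<Rightarrow> ennreal ^ 'm) \<Rightarrow> ('v \<times> (real ^ 'm)) set" where
  "epi_G E f =
     {(x, a). x \<in> E \<and> (\<forall>i. 0 < a $ i) \<and> (\<forall>i. enn2ereal (f x $ i) \<le> ereal (a $ i))}"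

end

theory Submission
  imports Defs
begin

text \<open>In the first coordinate, both epigraphs inherit closure under geometric means from
  \<open>E\<close>, so only the bound on \<open>f\<close> has to be checked, coordinate by
  coordinate. If \<open>f\<close> is GG-convex, finite upper bounds for \<open>f x\<close> and
  \<open>f y\<close> pass through the increasing power functions and products
  (\<open>gg_convex_prod_epi\<close>). Geometric means of positive numbers are positive, so closure
  descends from \<open>epi\<close> to \<open>epi_G\<close> (\<open>gg_convex_prod_epi_G\<close>). It
  ascends by a limit: add a small positive number to all bounds and use continuity of powers, also
  at base 0 (\<open>gg_convex_prod_epi_of_epi_G\<close>). If \<open>f\<close> is finite on
  \<open>E\<close>, its graph lies in \<open>epi E f\<close>, and closure applied to two graph
  points is the inequality for \<open>f\<close> (\<open>gg_convex_map_of_epi\<close>).\<close>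

text \<open>Moves the epigraph condition to \<open>ennreal\<close>; the sign condition must be kept
  because \<open>ennreal\<close> truncates negative reals to 0.\<close>

lemma enn2ereal_le_ereal_iff: "enn2ereal p \<le> ereal r \<longleftrightarrow> 0 \<le> r \<and> p \<le> ennreal r"
proof (cases "0 \<le> r")
  case True
  then show ?thesis by (simp add: less_eq_ennreal.rep_eq enn2ereal_ennreal)
next
  case False
  have "\<not> enn2ereal p \<le> ereal r"
  proof
    assume "enn2ereal p \<le> ereal r"
    with enn2ereal_nonneg[of p] have "0 \<le> ereal r" by (rule order_trans)
    with False show False by simp
  qed
  with False show ?thesis by simp
qed

lemma mem_epi_iff:
  "(x, a) \<in> epi E f \<longleftrightarrow> x \<in> E \<and> (\<forall>i. 0 \<le> a $ i \<and> f x $ i \<le> ennreal (a $ i))"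
  by (simp add: epi_def enn2ereal_le_ereal_iff)

lemma mem_epi_G_iff:
  "(x, a) \<in> epi_G E f \<longleftrightarrow> x \<in> E \<and> (\<forall>i. 0 < a $ i \<and> f x $ i \<le> ennreal (a $ i))"
  by (auto simp: epi_G_def enn2ereal_le_ereal_iff less_imp_le)

lemma ennreal_pow_ennreal:
  "0 \<le> r \<Longrightarrow> t \<noteq> 0 \<Longrightarrow> ennreal_pow (ennreal r) t = ennreal (r powr t)"
  by (simp add: ennreal_pow_def rpow_def)

text \<open>A real bound excludes p = \<infinity>, leaving monotonicity of real powers. For r < 0
  the hypothesis forces p = 0, and the left side is 0 because t > 0.\<close>

lemma ennreal_pow_mono:
  assumes "p \<le> ennreal r" "0 < t"
  shows "ennreal_pow p t \<le> ennreal (r powr t)"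
proof (cases p)
  case (real s)
  then show ?thesis
    using assms
    by (cases "0 \<le> r") (auto simp: ennreal_pow_def rpow_def ennreal_neg intro!: ennreal_leI powr_mono2)
next
  case top
  then show ?thesis using assms by (simp add: top_unique)
qed

text \<open>Both exponents are nonzero, so the convention for exponent 0 in \<open>rpow\<close> does
  not intervene. The rule rewrites a component of the whole product, hence
  \<open>vector_mult_component\<close> is removed from the simplifier where it is applied.\<close>

lemma vec_pow_mult_component:
  "0 < l \<Longrightarrow> l < 1 \<Longrightarrow>
    (vec_pow a l * vec_pow b (1 - l)) $ i = (a $ i) powr l * (b $ i) powr (1 - l)"
  by (simp add: vec_pow_def rpow_def)

lemma gg_convex_prod_iff:
  "gg_convex_prod A \<longleftrightarrow> A \<subseteq> {0..} \<times> {0..} \<and>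
    (\<forall>x a y b l. (x, a) \<in> A \<longrightarrow> (y, b) \<in> A \<longrightarrow> 0 < l \<longrightarrow> l < 1 \<longrightarrow>
      (am_pow x l * am_pow y (1 - l), vec_pow a l * vec_pow b (1 - l)) \<in> A)"
  by (simp add: gg_convex_prod_def gg_convex_wrt_def Ball_def split_paired_All) blast

lemma gg_convexD:
  "gg_convex E \<Longrightarrow> x \<in> E \<Longrightarrow> y \<in> E \<Longrightarrow> 0 < l \<Longrightarrow> l < 1 \<Longrightarrow>
    am_pow x l * am_pow y (1 - l) \<in> E"
  by (simp add: gg_convex_def gg_convex_wrt_def)

lemma epi_subset_nonneg: "E \<subseteq> {0..} \<Longrightarrow> epi E f \<subseteq> {0..} \<times> {0..}"
  by (auto simp: mem_epi_iff less_eq_vec_def)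

lemma epi_G_subset_epi: "epi_G E f \<subseteq> epi E f"
  by (auto simp: mem_epi_iff mem_epi_G_iff less_imp_le)

lemma gg_convex_prod_epi:
  fixes E :: "'v::am_algebra set" and f :: "'v \<Rightarrow> ennreal ^ 'm"
  assumes E: "E \<subseteq> {0..}" "gg_convex E" and f: "gg_convex_map E f"
  shows "gg_convex_prod (epi E f)"
  unfolding gg_convex_prod_iff
proof (intro conjI allI impI)
  show "epi E f \<subseteq> {0..} \<times> {0..}" using E(1) by (rule epi_subset_nonneg)
next
  fix x y :: 'v and a b :: "real ^ 'm" and l :: real
  assume xa: "(x, a) \<in> epi E f" and yb: "(y, b) \<in> epi E f" and l: "0 < l" "l < 1"
  let ?z = "am_pow x l * am_pow y (1 - l)"
  have "f ?z $ i \<le> ennreal ((a $ i) powr l * (b $ i) powr (1 - l))" for i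
  proof -
    have "f ?z $ i \<le> ennreal_pow (f x $ i) l * ennreal_pow (f y $ i) (1 - l)"
      using f xa yb l by (simp add: gg_convex_map_def mem_epi_iff)
    also have "\<dots> \<le> ennreal ((a $ i) powr l) * ennreal ((b $ i) powr (1 - l))"
      using xa yb l by (intro mult_mono ennreal_pow_mono) (simp_all add: mem_epi_iff)
    finally show ?thesis by (simp add: ennreal_mult)
  qed
  then show "(?z, vec_pow a l * vec_pow b (1 - l)) \<in> epi E f"
    using gg_convexD[OF E(2) _ _ l] xa yb
    by (simp add: mem_epi_iff vec_pow_mult_component l del: vector_mult_component)
qed

lemma gg_convex_prod_epi_G:
  fixes E :: "'v::am_algebra set" and f :: "'v \<Rightarrow> ennreal ^ 'm"
  assumes epi: "gg_convex_prod (epi E f)"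
  shows "gg_convex_prod (epi_G E f)"
  unfolding gg_convex_prod_iff
proof (intro conjI allI impI)
  show "epi_G E f \<subseteq> {0..} \<times> {0..}"
    using epi epi_G_subset_epi[of E f] by (auto simp: gg_convex_prod_iff)
next
  fix x y :: 'v and a b :: "real ^ 'm" and l :: real
  assume xa: "(x, a) \<in> epi_G E f" and yb: "(y, b) \<in> epi_G E f" and l: "0 < l" "l < 1"
  have "(am_pow x l * am_pow y (1 - l), vec_pow a l * vec_pow b (1 - l)) \<in> epi E f"
    using epi xa yb l epi_G_subset_epi unfolding gg_convex_prod_iff by blast
  \<comment> \<open>\<open>powr\<close> is positive at every nonzero base.\<close>
  moreover have "0 < (a $ i) powr l * (b $ i) powr (1 - l)" for i
    using xa yb by (simp add: mem_epi_G_iff less_imp_neq[THEN not_sym])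
  ultimately show "(am_pow x l * am_pow y (1 - l), vec_pow a l * vec_pow b (1 - l)) \<in> epi_G E f"
    by (simp add: mem_epi_iff mem_epi_G_iff vec_pow_mult_component l del: vector_mult_component)
qed

text \<open>
  Points of the epigraph are limits of points of the geometric epigraph: raise all coordinates
  by \<open>\<epsilon> > 0\<close> and let \<open>\<epsilon>\<close> tend to \<open>0\<close>.
\<close>

lemma gg_convex_prod_epi_of_epi_G:
  fixes E :: "'v::am_algebra set" and f :: "'v \<Rightarrow> ennreal ^ 'm"
  assumes E: "E \<subseteq> {0..}" "gg_convex E" and epi_G: "gg_convex_prod (epi_G E f)"
  shows "gg_convex_prod (epi E f)"
  unfolding gg_convex_prod_iff
proof (intro conjI allI impI)
  show "epi E f \<subseteq> {0..} \<times> {0..}" using E(1) by (rule epi_subset_nonneg)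
next
  fix x y :: 'v and a b :: "real ^ 'm" and l :: real
  assume xa: "(x, a) \<in> epi E f" and yb: "(y, b) \<in> epi E f" and l: "0 < l" "l < 1"
  let ?z = "am_pow x l * am_pow y (1 - l)"
  \<comment> \<open>Values of \<open>f\<close> are nonnegative, hence so are the coordinates of
    \<open>c\<close>, and adding \<open>e\<close> makes them positive.\<close>
  have raise: "(w, \<chi> i. c $ i + e) \<in> epi_G E f" if w: "(w, c) \<in> epi E f" and e: "0 < e" for w c e
  proof -
    have "f w $ i \<le> ennreal (c $ i + e)" for i
      by (rule order_trans[OF _ ennreal_leI[of "c $ i"]]) (use w e in \<open>simp_all add: mem_epi_iff\<close>)
    then show ?thesis
      using w e by (simp add: mem_epi_iff mem_epi_G_iff add_nonneg_pos)
  qed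
  \<comment> \<open>Raising alters only the second components, so \<open>?z\<close> is the same for
    all \<open>e\<close> and the left side is constant in the limit.\<close>
  have "f ?z $ i \<le> ennreal ((a $ i) powr l * (b $ i) powr (1 - l))" for i
  proof (rule tendsto_lowerbound)
    \<comment> \<open>The limit base may be 0; \<open>disjI2\<close> selects the case of
      \<open>tendsto_powr'\<close> with positive exponent and eventually nonnegative base.\<close>
    have "((\<lambda>e. (a $ i + e) powr l * (b $ i + e) powr (1 - l)) \<longlongrightarrow>
        (a $ i + 0) powr l * (b $ i + 0) powr (1 - l)) (at_right 0)"
      using xa yb l
      by (intro tendsto_mult tendsto_powr' tendsto_add tendsto_const tendsto_ident_at disjI2 conjI
            eventually_mono[OF eventually_at_right_less[of "0::real"]])
         (simp_all add: mem_epi_iff)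
    then show "((\<lambda>e. ennreal ((a $ i + e) powr l * (b $ i + e) powr (1 - l))) \<longlongrightarrow>
        ennreal ((a $ i) powr l * (b $ i) powr (1 - l))) (at_right 0)"
      by (intro tendsto_ennrealI) simp
    have "f ?z $ i \<le> ennreal ((a $ i + e) powr l * (b $ i + e) powr (1 - l))" if "0 < e" for e
    proof -
      have "(?z, vec_pow (\<chi> i. a $ i + e) l * vec_pow (\<chi> i. b $ i + e) (1 - l)) \<in> epi_G E f"
        using epi_G raise[OF xa that] raise[OF yb that] l unfolding gg_convex_prod_iff by blast
      then show ?thesis
        by (simp add: mem_epi_G_iff vec_pow_mult_component l del: vector_mult_component)
    qed
    then show "\<forall>\<^sub>F e in at_right 0.
        f ?z $ i \<le> ennreal ((a $ i + e) powr l * (b $ i + e) powr (1 - l))"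
      by (rule eventually_mono[OF eventually_at_right_less[of "0::real"]])
  qed simp
  then show "(?z, vec_pow a l * vec_pow b (1 - l)) \<in> epi E f"
    using gg_convexD[OF E(2) _ _ l] xa yb
    by (simp add: mem_epi_iff vec_pow_mult_component l del: vector_mult_component)
qed

text \<open>Finiteness puts a point of the epigraph above every x in \<open>E\<close>. Where f y =
  \<infinity> there is none, while 0 * \<infinity> = 0 may still make the bound required of
  \<open>f\<close> equal to 0.\<close>

lemma gg_convex_map_of_epi:
  fixes E :: "'v::am_algebra set" and f :: "'v \<Rightarrow> ennreal ^ 'm"
  assumes fin: "\<And>x i. x \<in> E \<Longrightarrow> f x $ i < \<infinity>" and epi: "gg_convex_prod (epi E f)"
  shows "gg_convex_map E f"
  unfolding gg_convex_map_def
proof (intro ballI allI)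
  fix x y l i
  assume x: "x \<in> E" and y: "y \<in> E" and "l \<in> {0<..<1::real}"
  then have l: "0 < l" "l < 1" by auto
  \<comment> \<open>\<open>enn2real\<close> sends \<infinity> to 0, so \<open>?g\<close> is only
    known to represent \<open>f\<close> on \<open>E\<close>.\<close>
  let ?g = "\<lambda>w. (\<chi> i. enn2real (f w $ i)) :: real ^ 'm"
  have g: "ennreal (?g w $ i) = f w $ i" if "w \<in> E" for w i
    using fin[OF that, of i] by simp
  have "(w, ?g w) \<in> epi E f" if "w \<in> E" for w
    using that g[OF that] by (simp add: mem_epi_iff)
  with x y have "(x, ?g x) \<in> epi E f" "(y, ?g y) \<in> epi E f" by blast+
  with epi l have "(am_pow x l * am_pow y (1 - l),
      vec_pow (?g x) l * vec_pow (?g y) (1 - l)) \<in> epi E f"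
    unfolding gg_convex_prod_iff by blast
  then have "f (am_pow x l * am_pow y (1 - l)) $ i
      \<le> ennreal ((?g x $ i) powr l * (?g y $ i) powr (1 - l))"
    by (simp add: mem_epi_iff vec_pow_mult_component l del: vector_mult_component)
  also have "\<dots> = ennreal_pow (ennreal (?g x $ i)) l * ennreal_pow (ennreal (?g y $ i)) (1 - l)"
    using l by (subst (1 2) ennreal_pow_ennreal) (simp_all add: ennreal_mult)
  finally show "f (am_pow x l * am_pow y (1 - l)) $ i
      \<le> ennreal_pow (f x $ i) l * ennreal_pow (f y $ i) (1 - l)"
    unfolding g[OF x] g[OF y] .
qed

theorem proposition2p12:
  fixes E :: "'v::am_algebra set" and f :: "'v \<Rightarrow> ennreal ^ 'm"
  assumes "E \<subseteq> {0..}" and "gg_convex E"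
  shows "(gg_convex_map E f \<longrightarrow> gg_convex_prod (epi E f)) \<and>
         (gg_convex_prod (epi E f) \<longleftrightarrow> gg_convex_prod (epi_G E f)) \<and>
         ((\<forall>x\<in>E. \<forall>i. f x $ i < \<infinity>) \<longrightarrow> gg_convex_prod (epi E f) \<longrightarrow> gg_convex_map E f)"
proof (intro conjI impI)
  show "gg_convex_prod (epi E f)" if "gg_convex_map E f"
    using assms that by (rule gg_convex_prod_epi)
  show "gg_convex_prod (epi E f) \<longleftrightarrow> gg_convex_prod (epi_G E f)"
    using gg_convex_prod_epi_G gg_convex_prod_epi_of_epi_G[OF assms] by (rule iffI)
  show "gg_convex_map E f" if "\<forall>x\<in>E. \<forall>i. f x $ i < \<infinity>" "gg_convex_prod (epi E f)"
    using that by (intro gg_convex_map_of_epi) simp_all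
qed

end
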